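(* Let $m\ge1$, let $\mathcal{G}=(V,\mathcal{E})$ be an undirected $(m+1)$-uniform hypergraph with $|V|=n\ge2$, let $E_0\notin\mathcal{E}$ be an $(m+1)$-element subset of $V$, and let $\mathcal{G}'=(V,\mathcal{E}\cup\{E_0\})$. Let $q_2$ be a (unit) Fiedler vector of $\mathcal{G}$. Then $$a(\mathcal{G}')\le a(\mathcal{G})+q_2^\top\mathcal{L}_{E_0}q_2,$$ where $\mathcal{L}_{E_0}$ is the Laplacian tensor of the hypergraph $(V,\{E_0\})$.
   Context: An undirected $(m+1)$-uniform hypergraph $\mathcal{G}=(V,\mathcal{E})$ consists of a finite vertex set $V=\{v_1,\dots,v_n\}$ and a set $\mathcal{E}$ of $(m+1)$-element subsets of $V$ (hyperedges). Adjacency tensor: $\mathcal{A}=(a_{i_1,\dots,i_{m+1}})$, with $a_{i_1,\dots,i_{m+1}}=\frac{1}{m!}$ if $\{v_{i_1},\dots,v_{i_{m+1}}\}\in\mathcal{E}$ (so the indices are distinct) and $0$ otherwise. For $x\in\mathbb{R}^n$ and an $(m+1)$th order $n$-dimensional real tensor $\mathcal{B}$, $x^\top\mathcal{B}\in\mathbb{R}^{1\times n}$ is defined by $(x^\top\mathcal{B})_j=\sum_{t,i_1,\dots,i_m=1}^n x_t\, b_{i_1,\dots,i_m,j}\,\delta(t\in\{i_1,\dots,i_m\})$, where $\delta(p)=1$ if $p$ is true and $0$ otherwise; and $x^\top\mathcal{B}x=\sum_j (x^\top\mathcal{B})_j x_j$. Degrees: $(d_1,\dots,d_n)=\mathbf{1}^\top\mathcal{A}$,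 where $\mathbf{1}$ is the all-ones vector. Laplacian tensor: $\mathcal{L}=\mathcal{D}-\mathcal{A}$, where $\mathcal{D}$ is the diagonal tensor with $\mathcal{D}_{i,\dots,i}=d_i$ and all other entries $0$. Algebraic connectivity: $a(\mathcal{G})=\min\{x^\top\mathcal{L}x : x\in\mathbb{R}^n,\ x\perp\mathbf{1},\ \|x\|_2=1\}$. A Fiedler vector of $\mathcal{G}$ is a unit vector $q_2\perp\mathbf{1}$ that is an eigenvector of $\mathcal{L}$ for the eigenvalue $a(\mathcal{G})$, i.e. $q_2^\top\mathcal{L}=a(\mathcal{G})q_2^\top$. *)

theory Defs
  imports "HOL-Analysis.Analysis"
begin

text \<open>
  The vertex set is the universe of a finite type \<open>'n\<close>, so that $n$ is \<open>CARD('n)\<close>, and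
  vertices double as indices of vectors and tensors. A hypergraph is given by its set of
  hyperedges.
\<close>

definition uniform_hypergraph :: "nat \<Rightarrow> 'n::finite set set \<Rightarrow> bool" where
  "uniform_hypergraph k E \<longleftrightarrow> (\<forall>e\<in>E. card e = k)"

text \<open>
  A tensor of order $k$ assigns an entry to every index list of length $k$. Its values on lists
  of other lengths are never used; the tensors defined below are $0$ there.
\<close>

type_synonym 'n tensor = "'n list \<Rightarrow> real"

definition adjacency_tensor :: "nat \<Rightarrow> 'n::finite set set \<Rightarrow> 'n tensor" where
  "adjacency_tensor m E = (\<lambda>is. if length is = m + 1 \<and> set is \<in> E then 1 / fact m else 0)"

definition diagonal_tensor :: "nat \<Rightarrow> real ^ 'n \<Rightarrow> 'n::finite tensor" where
  "diagonal_tensor m d = (\<lambda>is. if is = replicate (m + 1) (hd is) then d $ hd is else 0)"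

text \<open>The row vector $x^\top B$ for a tensor $B$ of order $m+1$; the list \<open>is\<close> is $(i_1,\dots,i_m)$.\<close>

definition vec_tensor :: "nat \<Rightarrow> real ^ 'n \<Rightarrow> 'n::finite tensor \<Rightarrow> real ^ 'n" where
  "vec_tensor m x B =
     (\<chi> j. \<Sum>t\<in>UNIV. \<Sum>is\<in>{is. length is = m}. x $ t * B (is @ [j]) * of_bool (t \<in> set is))"

definition tensor_form :: "nat \<Rightarrow> real ^ 'n \<Rightarrow> 'n::finite tensor \<Rightarrow> real" where
  "tensor_form m x B = (\<Sum>j\<in>UNIV. vec_tensor m x B $ j * x $ j)"

text \<open>Here and below, \<open>1 :: real ^ 'n\<close> is the all-ones vector.\<close>

definition degree_vec :: "nat \<Rightarrow> 'n::finite set set \<Rightarrow> real ^ 'n" where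
  "degree_vec m E = vec_tensor m 1 (adjacency_tensor m E)"

definition laplacian_tensor :: "nat \<Rightarrow> 'n::finite set set \<Rightarrow> 'n tensor" where
  "laplacian_tensor m E =
     (\<lambda>is. diagonal_tensor m (degree_vec m E) is - adjacency_tensor m E is)"

text \<open>
  \<open>LEAST\<close> denotes the minimum of the set of values, which exists by compactness as soon as there
  are at least two vertices.
\<close>

definition algebraic_connectivity :: "nat \<Rightarrow> 'n::finite set set \<Rightarrow> real" where
  "algebraic_connectivity m E =
     (LEAST a. a \<in> {tensor_form m x (laplacian_tensor m E) | x. orthogonal x 1 \<and> norm x = 1})"

definition fiedler_vector :: "nat \<Rightarrow> 'n::finite set set \<Rightarrow> real ^ 'n \<Rightarrow> bool" where
  "fiedler_vector m E q \<longleftrightarrow>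
     norm q = 1 \<and> orthogonal q 1 \<and>
     vec_tensor m q (laplacian_tensor m E) = algebraic_connectivity m E *\<^sub>R q"

end

theory Submission
  imports Defs
begin

text \<open>
  The Laplacian tensor is additive over disjoint edge sets, because each edge contributes its own
  adjacency entries, the degrees depend linearly on the adjacency tensor, and the Laplacian
  depends linearly on both. Hence the quadratic form of \<open>E \<union> {E\<^sub>0}\<close> at any \<open>x\<close> is the sum of the
  forms of \<open>E\<close> and \<open>{E\<^sub>0}\<close> at \<open>x\<close> (\<open>laplacian_tensor_Un_disjoint\<close>, \<open>tensor_form_add\<close>).

  The Fiedler vector \<open>q\<^sub>2\<close> of the old hypergraph is a unit vector orthogonal to the all-ones vector,
  so it is a competitor in the minimisation defining the connectivity of the new one
  (\<open>algebraic_connectivity_le\<close>). Its value there splits as above, and the old part is the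
  eigenvalue, by the eigenvector equation and \<open>norm q\<^sub>2 = 1\<close>.
\<close>

lemma vec_tensor_add:
  "vec_tensor m x (\<lambda>is. B is + C is) = vec_tensor m x B + vec_tensor m x C"
  by (simp add: vec_tensor_def vec_eq_iff algebra_simps sum.distrib)

lemma tensor_form_add:
  "tensor_form m x (\<lambda>is. B is + C is) = tensor_form m x B + tensor_form m x C"
  by (simp add: tensor_form_def vec_tensor_add algebra_simps sum.distrib)

lemma tensor_form_eq_inner: "tensor_form m x B = vec_tensor m x B \<bullet> x"
  by (simp add: tensor_form_def inner_vec_def)

lemma adjacency_tensor_Un_disjoint:
  assumes "E \<inter> F = {}"
  shows "adjacency_tensor m (E \<union> F) = (\<lambda>is. adjacency_tensor m E is + adjacency_tensor m F is)"
  using assms by (auto simp: adjacency_tensor_def fun_eq_iff)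

lemma diagonal_tensor_add:
  "diagonal_tensor m (d + d') is = diagonal_tensor m d is + diagonal_tensor m d' is"
proof (cases "is = replicate (m + 1) (hd is)")
  case True
  show ?thesis
    unfolding diagonal_tensor_def if_P[OF True] by (rule vector_add_component)
next
  case False
  show ?thesis
    unfolding diagonal_tensor_def if_not_P[OF False] by simp
qed

lemma laplacian_tensor_Un_disjoint:
  assumes "E \<inter> F = {}"
  shows "laplacian_tensor m (E \<union> F) = (\<lambda>is. laplacian_tensor m E is + laplacian_tensor m F is)"
proof -
  have "degree_vec m (E \<union> F) = degree_vec m E + degree_vec m F"
    by (simp add: degree_vec_def adjacency_tensor_Un_disjoint[OF assms] vec_tensor_add)
  then show ?thesis
    by (simp add: laplacian_tensor_def adjacency_tensor_Un_disjoint[OF assms]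
        diagonal_tensor_add fun_eq_iff)
qed

lemma continuous_on_tensor_form: "continuous_on S (\<lambda>x. tensor_form m x B)"
  unfolding tensor_form_def vec_tensor_def vec_lambda_beta by (intro continuous_intros)

text \<open>
  On the reals a \<open>LEAST\<close> bounds a set from below only if a least element exists. Here it does: a
  feasible vector makes the feasible set a nonempty compact set, on which the continuous form
  attains its minimum.
\<close>

lemma algebraic_connectivity_le:
  fixes x :: "real ^ 'n::finite"
  assumes "orthogonal x 1" and "norm x = 1"
  shows "algebraic_connectivity m E \<le> tensor_form m x (laplacian_tensor m E)"
proof -
  let ?f = "\<lambda>x. tensor_form m x (laplacian_tensor m E)"
  let ?S = "{x :: real ^ 'n. orthogonal x 1 \<and> norm x = 1}"
  have "compact (sphere 0 1 \<inter> {x :: real ^ 'n. 1 \<bullet> x = 0})"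
    by (intro compact_Int_closed compact_sphere closed_hyperplane)
  also have "sphere 0 1 \<inter> {x. 1 \<bullet> x = 0} = ?S"
    by (auto simp: orthogonal_def inner_commute)
  finally have "compact ?S" .
  moreover have "?S \<noteq> {}"
    using assms by blast
  ultimately have "\<exists>y\<in>?S. \<forall>z\<in>?S. ?f y \<le> ?f z"
    by (rule continuous_attains_inf) (rule continuous_on_tensor_form)
  then obtain y where y: "y \<in> ?S" and min: "\<And>z. z \<in> ?S \<Longrightarrow> ?f y \<le> ?f z"
    by blast
  have "algebraic_connectivity m E = ?f y"
    unfolding algebraic_connectivity_def using y min by (intro Least_equality) auto
  then show ?thesis
    using min assms by simp
qed

lemma tensor_form_fiedler_vector:
  assumes "fiedler_vector m E q"
  shows "tensor_form m q (laplacian_tensor m E) = algebraic_connectivity m E"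
  using assms by (simp add: tensor_form_eq_inner fiedler_vector_def dot_square_norm)

theorem proposition4p2:
  fixes m :: nat and E :: "'n::finite set set" and E\<^sub>0 :: "'n set" and q\<^sub>2 :: "real ^ 'n"
  assumes "m \<ge> 1"
    and "CARD('n) \<ge> 2"
    and "uniform_hypergraph (m + 1) E"
    and "card E\<^sub>0 = m + 1"
    and "E\<^sub>0 \<notin> E"
    and "fiedler_vector m E q\<^sub>2"
  shows "algebraic_connectivity m (E \<union> {E\<^sub>0})
    \<le> algebraic_connectivity m E + tensor_form m q\<^sub>2 (laplacian_tensor m {E\<^sub>0})"
proof -
  have "algebraic_connectivity m (E \<union> {E\<^sub>0})
      \<le> tensor_form m q\<^sub>2 (laplacian_tensor m (E \<union> {E\<^sub>0}))"
    using assms(6) by (intro algebraic_connectivity_le) (simp_all add: fiedler_vector_def)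
  also have "\<dots> = tensor_form m q\<^sub>2 (laplacian_tensor m E) + tensor_form m q\<^sub>2 (laplacian_tensor m {E\<^sub>0})"
    using assms(5) by (subst laplacian_tensor_Un_disjoint) (simp_all add: tensor_form_add)
  also have "tensor_form m q\<^sub>2 (laplacian_tensor m E) = algebraic_connectivity m E"
    using assms(6) by (rule tensor_form_fiedler_vector)
  finally show ?thesis .
qed

end
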